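(* Fix integers $d,n\ge 1$ with $\alpha=d/n<1$, constants $\sigma,\gamma>0$, a covariance matrix $\boldsymbol{\Sigma}\in\mathbb R^{d\times d}$, a vector $\mathbf w\in\mathbb R^d$ with $\|\mathbf w\|^2=d$, and an input $\mathbf x\in\mathbb R^d$. Suppose the reward weight equals the teacher weight, $\mathbf w_R=\mathbf w_T=\mathbf w$. Let $\delta_{T,k}(\mathbf x)$, $m(\mathbf x)$, $s(\mathbf x)^2$, $\mu_T(\mathbf x)$ be as in the context and put $\Delta_T(\mathbf x)=m(\mathbf x)-\mu_T(\mathbf x)$. Then, to leading order as $T\to0$ followed by $k\to\infty$, $$\delta_{T,k}(\mathbf x)=\frac{\pi}{k^2}\,s(\mathbf x)^2\exp\!\left(\frac{\Delta_T(\mathbf x)^2}{s(\mathbf x)^2}\right),$$ that is, $$\lim_{k\to\infty}k^2\lim_{T\to0^+}\delta_{T,k}(\mathbf x)=\pi\,s(\mathbf x)^2\exp\!\left(\frac{\Delta_T(\mathbf x)^2}{s(\mathbf x)^2}\right).$$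
   Context: Setting. $\boldsymbol{\Sigma}$ is a symmetric positive semidefinite $d\times d$ matrix (the input covariance), $\mathbf w_T$ is the teacher weight, $\mathbf w_R$ the reward weight, $\sigma^2$ the noise variance, $\gamma^2$ the prior variance, $n$ the number of training samples. Renormalized ridge. $R>0$ is the solution of $R\big(1-\alpha\, m_{\boldsymbol{\Sigma}}(R)\big)=\frac{\sigma^2}{\gamma^2}\alpha$, where $m_{\boldsymbol{\Sigma}}(R)=\frac1d\mathrm{Tr}\big[\boldsymbol{\Sigma}(\boldsymbol{\Sigma}+R\mathbf I)^{-1}\big]$. Set $\mathbf A_R=\boldsymbol{\Sigma}(\boldsymbol{\Sigma}+R\mathbf I)^{-1}$ and $\mathbf B_R=R(\boldsymbol{\Sigma}+R\mathbf I)^{-1}=\mathbf I-\mathbf A_R$. Predictive mean and variance: $m(\mathbf x)=\frac{1}{\sqrt d}\mathbf x^\top\mathbf A_R\mathbf w_T$ and $s(\mathbf x)^2=\sigma^2+\frac{\gamma^2}{d}\mathbf x^\top\mathbf B_R\mathbf x$. Also $\mu_T(\mathbf x)=\frac{1}{\sqrt d}\mathbf w_T\cdot\mathbf x$ and $\mu_R(\mathbf x)=\frac{1}{\sqrt d}\mathbf w_R\cdot\mathbf x$. Error at temperature $T>0$ with $k$ inference-time samples: $$\delta_{T,k}(\mathbf x)=\mathbb E\left[\frac{\sum_{i=1}^k (y_i-\mu_T(\mathbf x))^2e^{-(y_i-\mu_R(\mathbf x))^2/T}}{\sum_{j=1}^k e^{-(y_j-\mu_R(\mathbf x))^2/T}}\right],$$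 where $y_1,\dots,y_k$ are i.i.d. $\mathcal N(m(\mathbf x),s(\mathbf x)^2)$. *)

theory Defs
  imports "HOL-Probability.Probability"
begin

definition covariance_matrix :: "real^'d^'d \<Rightarrow> bool" where
  "covariance_matrix S \<longleftrightarrow> transpose S = S \<and> (\<forall>v. 0 \<le> v \<bullet> (S *v v))"

text \<open>In the next definitions \<open>mat R\<close> is \<open>R\<close> times the identity. For a covariance matrix
  \<open>S\<close> and \<open>R > 0\<close> the matrix \<open>S + mat R\<close> is positive definite, so \<open>matrix_inv\<close> is its inverse.\<close>

definition A_mat :: "real^'d^'d \<Rightarrow> real \<Rightarrow> real^'d^'d" where
  "A_mat S R = S ** matrix_inv (S + mat R)"

definition B_mat :: "real^'d^'d \<Rightarrow> real \<Rightarrow> real^'d^'d" where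
  "B_mat S R = R *\<^sub>R matrix_inv (S + mat R)"

definition m_cov :: "real^'d^'d \<Rightarrow> real \<Rightarrow> real" where
  "m_cov S R = 1 / real CARD('d) * trace (S ** matrix_inv (S + mat R))"

definition renormalized_ridge :: "real^'d^'d \<Rightarrow> real \<Rightarrow> real \<Rightarrow> real \<Rightarrow> real \<Rightarrow> bool" where
  "renormalized_ridge S \<alpha> \<sigma> \<gamma> R \<longleftrightarrow>
     R > 0 \<and> R * (1 - \<alpha> * m_cov S R) = \<sigma>\<^sup>2 / \<gamma>\<^sup>2 * \<alpha>"

definition pred_mean :: "real^'d^'d \<Rightarrow> real \<Rightarrow> real^'d \<Rightarrow> real^'d \<Rightarrow> real" where
  "pred_mean S R w\<^sub>T x = 1 / sqrt (real CARD('d)) * (x \<bullet> (A_mat S R *v w\<^sub>T))"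

definition pred_var :: "real^'d^'d \<Rightarrow> real \<Rightarrow> real \<Rightarrow> real \<Rightarrow> real^'d \<Rightarrow> real" where
  "pred_var S R \<sigma> \<gamma> x = \<sigma>\<^sup>2 + \<gamma>\<^sup>2 / real CARD('d) * (x \<bullet> (B_mat S R *v x))"

text \<open>Both the teacher mean (at \<open>w = w\<^sub>T\<close>) and the reward mean (at \<open>w = w\<^sub>R\<close>).\<close>

definition lin_mean :: "real^'d \<Rightarrow> real^'d \<Rightarrow> real" where
  "lin_mean w x = 1 / sqrt (real CARD('d)) * (w \<bullet> x)"

definition Delta_T :: "real^'d^'d \<Rightarrow> real \<Rightarrow> real^'d \<Rightarrow> real^'d \<Rightarrow> real" where
  "Delta_T S R w\<^sub>T x = pred_mean S R w\<^sub>T x - lin_mean w\<^sub>T x"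

text \<open>The second parameter of \<open>normal_density\<close> is the standard deviation. The expectation is
  taken over the joint law of \<open>k\<close> independent samples, i.e. the product measure.\<close>

definition normal_measure :: "real \<Rightarrow> real \<Rightarrow> real measure" where
  "normal_measure \<mu> v = density lborel (\<lambda>y. ennreal (normal_density \<mu> (sqrt v) y))"

definition delta_err ::
  "real^'d^'d \<Rightarrow> real \<Rightarrow> real \<Rightarrow> real \<Rightarrow> real^'d \<Rightarrow> real^'d \<Rightarrow> real^'d \<Rightarrow> real \<Rightarrow> nat \<Rightarrow> real" where
  "delta_err S R \<sigma> \<gamma> w\<^sub>T w\<^sub>R x T k =
     (\<integral>y. (\<Sum>i=1..k. (y i - lin_mean w\<^sub>T x)\<^sup>2 * exp (- ((y i - lin_mean w\<^sub>R x)\<^sup>2) / T)) /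
          (\<Sum>j=1..k. exp (- ((y j - lin_mean w\<^sub>R x)\<^sup>2) / T))
      \<partial>(\<Pi>\<^sub>M i\<in>{1..k}. normal_measure (pred_mean S R w\<^sub>T x) (pred_var S R \<sigma> \<gamma> x)))"

end

theory Submission
  imports Defs
begin

text \<open>As \<open>T \<longrightarrow> 0\<close> the Boltzmann average of the squared errors concentrates on the smallest one, up to
  an error of at most \<open>k * T\<close> uniformly in the samples, so the inner limit is the expectation of
  \<open>min\<^sub>i (y\<^sub>i - \<mu>\<^sub>T)\<^sup>2\<close>. By the layer cake formula and independence this is the integral of
  \<open>2 * u * P(u \<le> \<bar>y - \<mu>\<^sub>T\<bar>) ^ k\<close> over \<open>u \<ge> 0\<close>. Near \<open>u = 0\<close> the probability is
  \<open>1 - 2 * \<phi>(\<mu>\<^sub>T) * u + o(u)\<close> with \<open>\<phi>\<close> the Gaussian density of the samples, so scaling \<open>u = s / k\<close>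
  makes \<open>k\<^sup>2\<close> times the integral converge to that of \<open>2 * s * exp (- 2 * \<phi>(\<mu>\<^sub>T) * s)\<close>, which is
  \<open>1 / (2 * \<phi>(\<mu>\<^sub>T)\<^sup>2)\<close>.\<close>

section \<open>Limits of powers and the asymptotics of integrals of
  \<open>2 * u * q u ^ k\<close>\<close>

text \<open>After taking logarithms, \<open>real k * ln (1 - g k)\<close> is squeezed between
  \<open>- (real k * g k)\<close> and the same quantity minus a correction that vanishes because
  \<open>g\<close> tends to 0.\<close>

lemma tendsto_one_minus_power_exp:
  fixes g :: "nat \<Rightarrow> real"
  assumes lim: "(\<lambda>k. real k * g k) \<longlonglongrightarrow> a" and nonneg: "\<And>k. 0 \<le> g k"
  shows "(\<lambda>k. (1 - g k) ^ k) \<longlonglongrightarrow> exp (- a)"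
proof -
  have "(\<lambda>k. (real k * g k) * (1 / real k)) \<longlonglongrightarrow> a * 0"
    by (intro tendsto_mult lim lim_1_over_n)
  moreover have "\<forall>\<^sub>F k in sequentially. (real k * g k) * (1 / real k) = g k"
    using eventually_gt_at_top[of 0] by eventually_elim auto
  ultimately have g0: "g \<longlonglongrightarrow> 0"
    using tendsto_cong by fastforce
  \<comment> \<open>Below 1/2 the bound \<open>- x - 2 * x\<^sup>2 \<le> ln (1 - x)\<close> is
    available, and \<open>1 - g k\<close> is positive.\<close>
  have small: "\<forall>\<^sub>F k in sequentially. g k < 1/2"
    using g0 by (rule order_tendstoD) simp
  have "(\<lambda>k. real k * ln (1 - g k)) \<longlonglongrightarrow> - a"
  proof (rule tendsto_sandwich)
    show "(\<lambda>k. - (real k * g k) - 2 * (real k * g k) * g k) \<longlonglongrightarrow> - a"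
      using tendsto_diff[OF tendsto_minus[OF lim] tendsto_mult[OF tendsto_mult[OF tendsto_const lim] g0], of 2]
      by simp
    show "(\<lambda>k. - (real k * g k)) \<longlonglongrightarrow> - a"
      using lim by (rule tendsto_minus)
    show "\<forall>\<^sub>F k in sequentially. - (real k * g k) - 2 * (real k * g k) * g k \<le> real k * ln (1 - g k)"
      using small
    proof eventually_elim
      case (elim k)
      have "real k * (- g k - 2 * (g k)\<^sup>2) \<le> real k * ln (1 - g k)"
        using elim nonneg by (intro mult_left_mono ln_one_minus_pos_lower_bound) auto
      then show ?case by (simp add: algebra_simps power2_eq_square)
    qed
    show "\<forall>\<^sub>F k in sequentially. real k * ln (1 - g k) \<le> - (real k * g k)"
      using small
    proof eventually_elim
      case (elim k)
      have "real k * ln (1 - g k) \<le> real k * (- g k)"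
        using elim ln_add_one_self_le_self2[of "- g k"] by (intro mult_left_mono) auto
      then show ?case by simp
    qed
  qed
  then have "(\<lambda>k. exp (real k * ln (1 - g k))) \<longlonglongrightarrow> exp (- a)"
    by (rule tendsto_exp)
  moreover have "\<forall>\<^sub>F k in sequentially. exp (real k * ln (1 - g k)) = (1 - g k) ^ k"
    using small by eventually_elim (simp add: exp_of_nat_mult)
  ultimately show ?thesis
    using tendsto_cong by fast
qed

text \<open>The sequence is the square of \<open>real k * sqrt r ^ k\<close>, and
  \<open>sqrt r < 1\<close>.\<close>

lemma square_times_power_tendsto_0:
  fixes r :: real
  assumes "0 \<le> r" "r < 1"
  shows "(\<lambda>k. (real k)\<^sup>2 * r ^ k) \<longlonglongrightarrow> 0"
proof -
  have "(\<lambda>k. (real k * sqrt r ^ k)\<^sup>2) \<longlonglongrightarrow> 0\<^sup>2"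
    using assms by (intro tendsto_power powser_times_n_limit_0) auto
  moreover have "(real k * sqrt r ^ k)\<^sup>2 = (real k)\<^sup>2 * r ^ k" for k
    using assms by (simp add: power_mult_distrib power_mult[symmetric] mult.commute[of k 2])
                   (simp add: power_mult)
  ultimately show ?thesis by simp
qed

text \<open>The integrand is \<open>2 / c\<close> times that of the first moment
  \<open>1 / c\<close> of the exponential law with rate \<open>c\<close>. The factor
  \<open>max 0 u\<close> cuts the integral over the line down to the half-line.\<close>

lemma has_bochner_integral_linear_exp:
  fixes c :: real
  assumes "0 < c"
  shows "has_bochner_integral lborel (\<lambda>u. 2 * max 0 u * exp (- (c * u))) (2 / c\<^sup>2)"
proof (rule has_bochner_integral_nn_integral)
  have "(\<integral>\<^sup>+u. ennreal (2 * max 0 u * exp (- (c * u))) \<partial>lborel)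
      = (\<integral>\<^sup>+u. ennreal (2 / c) * ennreal (erlang_density 0 c u * u ^ 1) \<partial>lborel)"
    using assms
    by (intro nn_integral_cong) (auto simp: erlang_density_def ennreal_mult'[symmetric] max_def)
  also have "\<dots> = ennreal (2 / c) * (\<integral>\<^sup>+u. ennreal (erlang_density 0 c u * u ^ 1) \<partial>lborel)"
    by (rule nn_integral_cmult) auto
  also have "(\<integral>\<^sup>+u. ennreal (erlang_density 0 c u * u ^ 1) \<partial>lborel) = ennreal (1 / c)"
    by (subst nn_integral_erlang_ith_moment[OF assms]) simp
  also have "ennreal (2 / c) * ennreal (1 / c) = ennreal (2 / c\<^sup>2)"
    using assms by (simp add: ennreal_mult'[symmetric] power2_eq_square)
  finally show "(\<integral>\<^sup>+u. ennreal (2 * max 0 u * exp (- (c * u))) \<partial>lborel) = ennreal (2 / c\<^sup>2)" .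
qed (use assms in auto)

text \<open>Split at a small \<open>e > 0\<close>: beyond \<open>e\<close> the integral decays like \<open>q e ^ k\<close>, and on \<open>[0, e]\<close> the
  substitution \<open>u = s / k\<close> absorbs \<open>k\<^sup>2\<close>, with \<open>q (s / k) ^ k\<close> tending to \<open>exp (- (c * s))\<close> and
  dominated by \<open>exp (- (c / 2 * s))\<close>.\<close>

lemma survival_power_integral_asymptotics:
  fixes q :: "real \<Rightarrow> real" and c :: real
  assumes meas [measurable]: "q \<in> borel_measurable borel"
    and q0: "\<And>u. 0 \<le> q u" and q1: "\<And>u. q u \<le> 1"
    and mono: "\<And>u v. 0 \<le> u \<Longrightarrow> u \<le> v \<Longrightarrow> q v \<le> q u"
    and lim: "((\<lambda>u. (1 - q u) / u) \<longlongrightarrow> c) (at_right 0)" and "0 < c"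
    and int: "integrable lborel (\<lambda>u. 2 * max 0 u * q u)"
  shows "(\<lambda>k. (real k)\<^sup>2 * (LBINT u. 2 * max 0 u * q u ^ k)) \<longlonglongrightarrow> 2 / c\<^sup>2"
proof -
  have "\<forall>\<^sub>F u in at_right 0. c / 2 < (1 - q u) / u"
    using lim by (rule order_tendstoD) (use \<open>0 < c\<close> in auto)
  then obtain d where d: "0 < d" "\<And>u. 0 < u \<Longrightarrow> u < d \<Longrightarrow> c / 2 < (1 - q u) / u"
    unfolding eventually_at_right_field by auto
  \<comment> \<open>Halving \<open>d\<close> makes the linear bound on \<open>q\<close> valid up to
    and including the endpoint \<open>e\<close>.\<close>
  define e where "e = d / 2"
  have e: "0 < e" using d by (simp add: e_def)
  have near: "q u \<le> 1 - c / 2 * u" if "0 < u" "u \<le> e" for u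
    using d(2)[of u] that d(1) by (simp add: e_def field_simps)
  define r where "r = q e"
  have r: "0 \<le> r" "r < 1"
  proof -
    have "0 < c / 2 * e" using \<open>0 < c\<close> e by simp
    then show "r < 1" using near[of e] e unfolding r_def by linarith
  qed (simp add: r_def q0)
  let ?h = "\<lambda>k u. 2 * max 0 u * q u ^ k"
  let ?head = "\<lambda>k u. ?h k u * indicator {..e} u"
  let ?tail = "\<lambda>k u. ?h k u * indicator {e<..} u"
  \<comment> \<open>For \<open>k = 0\<close> the integrand is \<open>2 * max 0 u\<close>, which is
    not integrable.\<close>
  have int_pow: "integrable lborel (?h k)" if "1 \<le> k" for k
  proof (rule Bochner_Integration.integrable_bound[OF int])
    have "q u ^ k \<le> q u ^ 1" for u using q0 q1 that by (intro power_decreasing) auto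
    then show "AE u in lborel. norm (?h k u) \<le> norm (2 * max 0 u * q u)"
      using q0 by (intro AE_I2) (auto simp: abs_mult intro!: mult_left_mono)
  qed auto
  have int_head: "integrable lborel (?head k)" and int_tail: "integrable lborel (?tail k)"
    if "1 \<le> k" for k
    using integrable_real_mult_indicator[OF _ int_pow[OF that]] by simp_all
  have split: "(LBINT u. ?h k u) = (LBINT u. ?head k u) + (LBINT u. ?tail k u)" if "1 \<le> k" for k
  proof -
    have "(LBINT u. ?h k u) = (LBINT u. ?head k u + ?tail k u)"
      by (intro Bochner_Integration.integral_cong) (auto simp: indicator_def)
    then show ?thesis
      using int_head[OF that] int_tail[OF that] by simp
  qed
  have tail: "(\<lambda>k. (real k)\<^sup>2 * (LBINT u. ?tail k u)) \<longlonglongrightarrow> 0"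
  proof -
    let ?I = "LBINT u. 2 * max 0 u * q u"
    \<comment> \<open>One of the \<open>Suc k\<close> factors \<open>q u\<close> is kept for
      integrability; the others are at most \<open>r\<close> each.\<close>
    have bound: "(LBINT u. ?tail (Suc k) u) \<le> r ^ k * ?I" for k
    proof -
      have "(LBINT u. ?tail (Suc k) u) \<le> (LBINT u. r ^ k * (2 * max 0 u * q u))"
      proof (rule integral_mono)
        show "?tail (Suc k) u \<le> r ^ k * (2 * max 0 u * q u)" for u
        proof (cases "e < u")
          case True
          then have "q u ^ k \<le> r ^ k"
            unfolding r_def using e q0 by (intro power_mono mono) auto
          then have "q u ^ k * (2 * max 0 u * q u) \<le> r ^ k * (2 * max 0 u * q u)"
            using q0 by (intro mult_right_mono) auto
          then show ?thesis using True by (simp add: mult_ac)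
        qed (use q0 r in auto)
        show "integrable lborel (?tail (Suc k))" by (rule int_tail) simp
        show "integrable lborel (\<lambda>u. r ^ k * (2 * max 0 u * q u))" using int by simp
      qed
      then show ?thesis using int by simp
    qed
    have "(\<lambda>k. ((real k)\<^sup>2 * r ^ k + 2 * (real k * r ^ k) + r ^ k) * ?I) \<longlonglongrightarrow> (0 + 2 * 0 + 0) * ?I"
      using r by (intro tendsto_intros square_times_power_tendsto_0 powser_times_n_limit_0) auto
    then have upper: "(\<lambda>k. ((real k)\<^sup>2 * r ^ k + 2 * (real k * r ^ k) + r ^ k) * ?I) \<longlonglongrightarrow> 0"
      by simp
    have "(\<lambda>k. (real (Suc k))\<^sup>2 * (LBINT u. ?tail (Suc k) u)) \<longlonglongrightarrow> 0"
    proof (rule tendsto_sandwich[OF _ _ tendsto_const upper])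
      show "\<forall>\<^sub>F k in sequentially. 0 \<le> (real (Suc k))\<^sup>2 * (LBINT u. ?tail (Suc k) u)"
        using q0 by (intro always_eventually allI mult_nonneg_nonneg Bochner_Integration.integral_nonneg) auto
      show "\<forall>\<^sub>F k in sequentially. (real (Suc k))\<^sup>2 * (LBINT u. ?tail (Suc k) u)
          \<le> ((real k)\<^sup>2 * r ^ k + 2 * (real k * r ^ k) + r ^ k) * ?I"
      proof (intro always_eventually allI)
        fix k
        have "(real (Suc k))\<^sup>2 * (LBINT u. ?tail (Suc k) u) \<le> (real (Suc k))\<^sup>2 * (r ^ k * ?I)"
          using bound by (intro mult_left_mono) auto
        then show "(real (Suc k))\<^sup>2 * (LBINT u. ?tail (Suc k) u)
          \<le> ((real k)\<^sup>2 * r ^ k + 2 * (real k * r ^ k) + r ^ k) * ?I"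
          by (simp add: power2_eq_square algebra_simps)
      qed
    qed
    then show ?thesis by (rule LIMSEQ_imp_Suc)
  qed
  \<comment> \<open>Of the two factors \<open>real k\<close>, one cancels the Jacobian of
    \<open>u = s / k\<close> and the other cancels the denominator in
    \<open>max 0 (s / real k)\<close>.\<close>
  have rescale: "(real k)\<^sup>2 * (LBINT u. ?head k u)
      = (LBINT s. 2 * max 0 s * q (s / real k) ^ k * indicator {..e} (s / real k))" if "1 \<le> k" for k
  proof -
    have max: "max 0 (s / real k) = max 0 s / real k" for s
      using that by (auto simp: max_def zero_le_divide_iff divide_le_0_iff)
    have "(LBINT u. ?head k u) = (LBINT s. ?head k (s / real k)) / real k"
      using lborel_integral_real_affine[of "1 / real k" "?head k" 0] that by simp
    then have "(real k)\<^sup>2 * (LBINT u. ?head k u) = (LBINT s. real k * ?head k (s / real k))"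
      using that by (simp add: power2_eq_square)
    then show ?thesis
      using that by (simp add: max mult_ac)
  qed
  let ?F = "\<lambda>k s. 2 * max 0 s * q (s / real k) ^ k * indicator {..e} (s / real k)"
  \<comment> \<open>The shift to \<open>Suc k\<close> avoids \<open>k = 0\<close>, where
    \<open>s / 0 = 0\<close> turns the integrand into \<open>2 * max 0 s\<close>, which the majorant
    does not dominate.\<close>
  have "(\<lambda>k. LBINT s. ?F (Suc k) s) \<longlonglongrightarrow> (LBINT s. 2 * max 0 s * exp (- (c * s)))"
  proof (rule integral_dominated_convergence[where w = "\<lambda>s. 2 * max 0 s * exp (- (c / 2 * s))"])
    show "integrable lborel (\<lambda>s. 2 * max 0 s * exp (- (c / 2 * s)))"
      using has_bochner_integral_linear_exp[of "c / 2"] \<open>0 < c\<close> by (auto simp: has_bochner_integral_iff)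
    have dom: "norm (?F k s) \<le> 2 * max 0 s * exp (- (c / 2 * s))" if "1 \<le> k" for k s
    proof (cases "0 < s \<and> s / real k \<le> e")
      case True
      then have "q (s / real k) \<le> 1 + (- (c / 2 * s) / real k)"
        using near[of "s / real k"] that by simp
      also have "\<dots> \<le> exp (- (c / 2 * s) / real k)" by (rule exp_ge_add_one_self)
      finally have "q (s / real k) ^ k \<le> exp (- (c / 2 * s) / real k) ^ k"
        using q0 by (intro power_mono)
      also have "\<dots> = exp (- (c / 2 * s))"
        using that by (simp add: exp_of_nat_mult[symmetric])
      finally show ?thesis using True q0 by (simp add: abs_mult)
    qed (cases "0 < s"; auto simp: max_def)
    show "AE s in lborel. norm (?F (Suc k) s) \<le> 2 * max 0 s * exp (- (c / 2 * s))" for k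
      by (intro AE_I2 dom) simp
    have "(\<lambda>k. ?F k s) \<longlonglongrightarrow> 2 * max 0 s * exp (- (c * s))" for s
    proof (cases "0 < s")
      case True
      have s0: "(\<lambda>k. s / real k) \<longlonglongrightarrow> 0" by (rule lim_const_over_n)
      have "\<forall>\<^sub>F k in sequentially. s / real k \<in> {0<..} \<and> s / real k \<noteq> 0"
        using eventually_gt_at_top[of 0] by eventually_elim (use True in auto)
      with s0 have "filterlim (\<lambda>k. s / real k) (at_right 0) sequentially"
        by (simp only: filterlim_at simp_thms)
      then have "(\<lambda>k. (1 - q (s / real k)) / (s / real k)) \<longlonglongrightarrow> c"
        by (rule filterlim_compose[OF lim])
      then have "(\<lambda>k. (1 - q (s / real k)) / (s / real k) * s) \<longlonglongrightarrow> c * s"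
        by (intro tendsto_intros)
      then have "(\<lambda>k. real k * (1 - q (s / real k))) \<longlonglongrightarrow> c * s"
        using True by (simp add: mult.commute)
      then have "(\<lambda>k. (1 - (1 - q (s / real k))) ^ k) \<longlonglongrightarrow> exp (- (c * s))"
        by (rule tendsto_one_minus_power_exp) (use q1 in auto)
      then have "(\<lambda>k. 2 * max 0 s * q (s / real k) ^ k) \<longlonglongrightarrow> 2 * max 0 s * exp (- (c * s))"
        by (intro tendsto_intros) auto
      moreover have "\<forall>\<^sub>F k in sequentially. s / real k < e"
        using s0 e by (rule order_tendstoD)
      then have "\<forall>\<^sub>F k in sequentially. 2 * max 0 s * q (s / real k) ^ k
          = 2 * max 0 s * q (s / real k) ^ k * indicator {..e} (s / real k)"
        by eventually_elim auto
      ultimately show ?thesis by (rule Lim_transform_eventually)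
    qed (auto simp: max_def)
    then show "AE s in lborel. (\<lambda>k. ?F (Suc k) s) \<longlonglongrightarrow> 2 * max 0 s * exp (- (c * s))"
      by (intro AE_I2 LIMSEQ_Suc)
  qed auto
  then have "(\<lambda>k. LBINT s. ?F k s) \<longlonglongrightarrow> (LBINT s. 2 * max 0 s * exp (- (c * s)))"
    by (rule LIMSEQ_imp_Suc)
  also have "(LBINT s. 2 * max 0 s * exp (- (c * s))) = 2 / c\<^sup>2"
    using has_bochner_integral_linear_exp[OF \<open>0 < c\<close>] by (simp add: has_bochner_integral_iff)
  finally have "(\<lambda>k. (LBINT s. ?F k s) + (real k)\<^sup>2 * (LBINT u. ?tail k u)) \<longlonglongrightarrow> 2 / c\<^sup>2 + 0"
    using tail by (rule tendsto_add)
  moreover have "\<forall>\<^sub>F k in sequentially. (LBINT s. ?F k s) + (real k)\<^sup>2 * (LBINT u. ?tail k u) = (real k)\<^sup>2 * (LBINT u. ?h k u)"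
    using eventually_ge_at_top[of 1]
  proof eventually_elim
    case (elim k)
    then show ?case by (simp only: split[OF elim] rescale[OF elim, symmetric] distrib_left)
  qed
  ultimately show ?thesis
    by (simp add: Lim_transform_eventually)
qed

section \<open>The zero-temperature limit of a Boltzmann average\<close>

text \<open>The upper bound comes from \<open>z * exp (- z) \<le> 1\<close> at \<open>z = (a i - m) / T\<close>, where \<open>m\<close> is the minimum.\<close>

lemma softmin_bounds:
  fixes a :: "'i \<Rightarrow> real"
  assumes "finite I" "I \<noteq> {}" "0 < T"
  shows "Min (a ` I) \<le> (\<Sum>i\<in>I. a i * exp (- a i / T)) / (\<Sum>j\<in>I. exp (- a j / T))" (is "?m \<le> ?N / ?Z")
    and "(\<Sum>i\<in>I. a i * exp (- a i / T)) / (\<Sum>j\<in>I. exp (- a j / T)) \<le> Min (a ` I) + real (card I) * T"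
proof -
  have Z: "0 < ?Z" using assms by (intro sum_pos) auto
  have m_le: "?m \<le> a i" if "i \<in> I" for i using assms that by auto
  have "?m * ?Z \<le> ?N"
    unfolding sum_distrib_left using m_le by (intro sum_mono mult_right_mono) auto
  then show "?m \<le> ?N / ?Z" using Z by (simp add: pos_le_divide_eq)
  have "?m \<in> a ` I" using assms by (intro Min_in) auto
  then obtain l where l: "l \<in> I" "a l = ?m" by (metis imageE)
  \<comment> \<open>The partition sum contains the term of the minimiser \<open>l\<close>.\<close>
  have "exp (- ?m / T) \<le> ?Z"
    using member_le_sum[of l I "\<lambda>j. exp (- a j / T)"] l assms by simp
  then have excess: "(a i - ?m) * exp (- a i / T) \<le> T * ?Z" if "i \<in> I" for i
  proof -
    have "(a i - ?m) / T \<le> exp ((a i - ?m) / T)"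
      using exp_ge_add_one_self[of "(a i - ?m) / T"] by linarith
    then have "a i - ?m \<le> T * exp ((a i - ?m) / T)"
      using assms by (simp add: pos_divide_le_eq mult.commute)
    then have "(a i - ?m) * exp (- a i / T) \<le> T * exp ((a i - ?m) / T) * exp (- a i / T)"
      by (intro mult_right_mono) auto
    also have "\<dots> = T * exp (- ?m / T)"
      by (simp add: mult.assoc exp_add[symmetric] diff_divide_distrib)
    also have "\<dots> \<le> T * ?Z" using \<open>exp (- ?m / T) \<le> ?Z\<close> assms by simp
    finally show ?thesis .
  qed
  have "?N - ?m * ?Z = (\<Sum>i\<in>I. (a i - ?m) * exp (- a i / T))"
    by (simp add: sum_distrib_left left_diff_distrib sum_subtractf)
  also have "\<dots> \<le> real (card I) * (T * ?Z)"
    using sum_bounded_above[of I "\<lambda>i. (a i - ?m) * exp (- a i / T)" "T * ?Z"] excess by simp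
  finally have "?N \<le> (?m + real (card I) * T) * ?Z" by (simp add: algebra_simps)
  then show "?N / ?Z \<le> ?m + real (card I) * T" using Z by (simp add: pos_divide_le_eq)
qed

text \<open>The pointwise gap of at most \<open>card I * T\<close> does not depend on the sample, so
  it survives integration and a sandwich suffices. Any single \<open>X l\<close> dominates the
  minimum, which makes it integrable.\<close>

lemma (in prob_space) expectation_softmin_tendsto:
  fixes X :: "'i \<Rightarrow> 'a \<Rightarrow> real"
  assumes I: "finite I" "I \<noteq> {}"
    and X: "\<And>i. i \<in> I \<Longrightarrow> integrable M (X i)" and nonneg: "\<And>i \<omega>. i \<in> I \<Longrightarrow> 0 \<le> X i \<omega>"
  shows "((\<lambda>T. expectation (\<lambda>\<omega>. (\<Sum>i\<in>I. X i \<omega> * exp (- X i \<omega> / T)) / (\<Sum>j\<in>I. exp (- X j \<omega> / T))))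
      \<longlongrightarrow> expectation (\<lambda>\<omega>. Min ((\<lambda>i. X i \<omega>) ` I))) (at_right 0)"
proof -
  let ?m = "\<lambda>\<omega>. Min ((\<lambda>i. X i \<omega>) ` I)"
  let ?s = "\<lambda>T \<omega>. (\<Sum>i\<in>I. X i \<omega> * exp (- X i \<omega> / T)) / (\<Sum>j\<in>I. exp (- X j \<omega> / T))"
  note [measurable] = borel_measurable_integrable[OF X]
  have m0: "0 \<le> ?m \<omega>" for \<omega> using I nonneg by auto
  obtain l where l: "l \<in> I" using I by auto
  have m_int: "integrable M ?m"
  proof (rule Bochner_Integration.integrable_bound[OF X[OF l]])
    show "?m \<in> borel_measurable M" using I by measurable
    show "AE \<omega> in M. norm (?m \<omega>) \<le> norm (X l \<omega>)"
      using m0 I l nonneg by (intro AE_I2) auto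
  qed
  have bounds: "expectation ?m \<le> expectation (?s T) \<and> expectation (?s T) \<le> expectation ?m + real (card I) * T"
    if "0 < T" for T
  proof -
    note b = softmin_bounds[OF I that, of "\<lambda>i. X i _"]
    have s_int: "integrable M (?s T)"
    proof (rule Bochner_Integration.integrable_bound)
      show "integrable M (\<lambda>\<omega>. ?m \<omega> + real (card I) * T)" using m_int by simp
      show "?s T \<in> borel_measurable M" by measurable
      show "AE \<omega> in M. norm (?s T \<omega>) \<le> norm (?m \<omega> + real (card I) * T)"
        using order_trans[OF m0 b(1)] b(2) by (intro AE_I2) (smt (verit) real_norm_def)
    qed
    have "expectation ?m \<le> expectation (?s T)"
      by (rule integral_mono[OF m_int s_int b(1)])
    moreover have "expectation (?s T) \<le> expectation (\<lambda>\<omega>. ?m \<omega> + real (card I) * T)"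
      by (rule integral_mono[OF s_int _ b(2)]) (use m_int in simp)
    ultimately show ?thesis using m_int by (simp add: prob_space)
  qed
  show ?thesis
  proof (rule tendsto_sandwich)
    show "((\<lambda>T. expectation ?m) \<longlongrightarrow> expectation ?m) (at_right 0)" by (rule tendsto_const)
    have "((\<lambda>T. expectation ?m + real (card I) * T) \<longlongrightarrow> expectation ?m + real (card I) * 0) (at_right 0)"
      by (intro tendsto_intros)
    then show "((\<lambda>T. expectation ?m + real (card I) * T) \<longlongrightarrow> expectation ?m) (at_right 0)" by simp
    show "\<forall>\<^sub>F T in at_right 0. expectation ?m \<le> expectation (?s T)"
      and "\<forall>\<^sub>F T in at_right 0. expectation (?s T) \<le> expectation ?m + real (card I) * T"
      using eventually_at_right_less[of "0::real"] by (eventually_elim; use bounds in blast)+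
  qed
qed

section \<open>Layer cake formula and minima of independent samples\<close>

text \<open>A number \<open>y \<ge> 0\<close> is the integral of \<open>2 * u\<close> over
  \<open>{0..sqrt y}\<close>; Tonelli then exchanges the integrals. Squaring the level makes
  \<open>u\<close> a distance when \<open>Y\<close> is a squared error.\<close>

lemma (in sigma_finite_measure) nn_integral_square_layer_cake:
  assumes [measurable]: "Y \<in> borel_measurable M" and nonneg: "\<And>\<omega>. 0 \<le> Y \<omega>"
  shows "(\<integral>\<^sup>+\<omega>. ennreal (Y \<omega>) \<partial>M)
    = (\<integral>\<^sup>+u. ennreal (2 * max 0 u) * emeasure M {\<omega> \<in> space M. u\<^sup>2 \<le> Y \<omega>} \<partial>lborel)"
proof -
  interpret pair_sigma_finite M lborel ..
  have "ennreal (Y \<omega>) = (\<integral>\<^sup>+u. ennreal (2 * max 0 u) * indicator {\<omega> \<in> space M. u\<^sup>2 \<le> Y \<omega>} \<omega> \<partial>lborel)"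
    if "\<omega> \<in> space M" for \<omega>
  proof -
    have "(\<integral>\<^sup>+u. ennreal (2 * u) * indicator {0..sqrt (Y \<omega>)} u \<partial>lborel) = (sqrt (Y \<omega>))\<^sup>2 - 0\<^sup>2"
      by (rule nn_integral_FTC_Icc) (use nonneg in \<open>auto intro!: derivative_eq_intros\<close>)
    moreover have "ennreal (2 * u) * indicator {0..sqrt (Y \<omega>)} u
        = ennreal (2 * max 0 u) * indicator {\<omega> \<in> space M. u\<^sup>2 \<le> Y \<omega>} \<omega>" for u
    proof (cases "0 \<le> u")
      case True
      then have "u \<le> sqrt (Y \<omega>) \<longleftrightarrow> u\<^sup>2 \<le> Y \<omega>"
        using real_le_rsqrt real_sqrt_le_iff[of "u\<^sup>2"] by auto
      then show ?thesis using True that by (auto split: split_indicator)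
    qed (auto simp: max_def split: split_indicator)
    ultimately show ?thesis using nonneg by simp
  qed
  then have "(\<integral>\<^sup>+\<omega>. ennreal (Y \<omega>) \<partial>M)
      = (\<integral>\<^sup>+\<omega>. (\<integral>\<^sup>+u. ennreal (2 * max 0 u) * indicator {\<omega> \<in> space M. u\<^sup>2 \<le> Y \<omega>} \<omega> \<partial>lborel) \<partial>M)"
    by (rule nn_integral_cong)
  also have "\<dots> = (\<integral>\<^sup>+u. (\<integral>\<^sup>+\<omega>. ennreal (2 * max 0 u) * indicator {\<omega> \<in> space M. u\<^sup>2 \<le> Y \<omega>} \<omega> \<partial>M) \<partial>lborel)"
    by (rule Fubini'[symmetric]) measurable
  also have "\<dots> = (\<integral>\<^sup>+u. ennreal (2 * max 0 u) * emeasure M {\<omega> \<in> space M. u\<^sup>2 \<le> Y \<omega>} \<partial>lborel)"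
    by (intro nn_integral_cong nn_integral_cmult_indicator) measurable
  finally show ?thesis .
qed

lemma (in prob_space) expectation_iid_Min:
  fixes f :: "'a \<Rightarrow> real" and I :: "'i set"
  defines "q \<equiv> \<lambda>u. measure M {y \<in> space M. u\<^sup>2 \<le> f y}"
  assumes [measurable]: "f \<in> borel_measurable M" and nonneg: "\<And>y. 0 \<le> f y"
    and I: "finite I" "I \<noteq> {}"
  shows "(\<integral>\<^sup>+\<omega>. ennreal (Min ((\<lambda>i. f (\<omega> i)) ` I)) \<partial>(\<Pi>\<^sub>M i\<in>I. M))
    = (\<integral>\<^sup>+u. ennreal (2 * max 0 u * q u ^ card I) \<partial>lborel)"
proof -
  interpret P: finite_product_prob_space "\<lambda>_. M" I by standard (rule I)
  let ?P = "\<Pi>\<^sub>M i\<in>I. M"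
  have meas: "(\<lambda>\<omega>. Min ((\<lambda>i. f (\<omega> i)) ` I)) \<in> borel_measurable ?P"
    using I by measurable
  have tail: "emeasure ?P {\<omega> \<in> space ?P. u\<^sup>2 \<le> Min ((\<lambda>i. f (\<omega> i)) ` I)} = ennreal (q u ^ card I)" for u
  proof -
    \<comment> \<open>The minimum reaches a level exactly when every coordinate does, so the event
      is a box and its probability is a product.\<close>
    have "{\<omega> \<in> space ?P. u\<^sup>2 \<le> Min ((\<lambda>i. f (\<omega> i)) ` I)} = (\<Pi>\<^sub>E i\<in>I. {y \<in> space M. u\<^sup>2 \<le> f y})"
      using I by (auto simp: space_PiM PiE_iff extensional_def)
    moreover have "emeasure ?P (\<Pi>\<^sub>E i\<in>I. {y \<in> space M. u\<^sup>2 \<le> f y}) = (\<Prod>i\<in>I. emeasure M {y \<in> space M. u\<^sup>2 \<le> f y})"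
      by (rule P.measure_times) measurable
    ultimately show ?thesis
      by (simp add: emeasure_eq_measure q_def ennreal_power)
  qed
  have "0 \<le> Min ((\<lambda>i. f (\<omega> i)) ` I)" for \<omega> using I nonneg by simp
  then have "(\<integral>\<^sup>+\<omega>. ennreal (Min ((\<lambda>i. f (\<omega> i)) ` I)) \<partial>?P)
      = (\<integral>\<^sup>+u. ennreal (2 * max 0 u) * ennreal (q u ^ card I) \<partial>lborel)"
    unfolding tail[symmetric] by (rule P.nn_integral_square_layer_cake[OF meas])
  then show ?thesis
    by (simp add: ennreal_mult'[symmetric])
qed

text \<open>Here \<open>c\<close> is the slope at 0 of the distribution function of
  \<open>sqrt f\<close>; only this local behaviour enters the limit.\<close>

lemma (in prob_space) expectation_iid_Min_asymptotics:
  fixes f :: "'a \<Rightarrow> real" and c :: real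
  assumes int: "integrable M f" and nonneg: "\<And>y. 0 \<le> f y"
    and lim: "((\<lambda>u. prob {y \<in> space M. f y < u\<^sup>2} / u) \<longlongrightarrow> c) (at_right 0)" and "0 < c"
  shows "(\<lambda>k. (real k)\<^sup>2 * (\<integral>\<omega>. Min ((\<lambda>i. f (\<omega> i)) ` {1..k}) \<partial>(\<Pi>\<^sub>M i\<in>{1..k}. M))) \<longlonglongrightarrow> 2 / c\<^sup>2"
proof -
  define q where "q u = prob {y \<in> space M. u\<^sup>2 \<le> f y}" for u
  have [measurable]: "f \<in> borel_measurable M" using int by simp
  have q_mono: "q v \<le> q u" if "0 \<le> u" "u \<le> v" for u v
  proof -
    have "u\<^sup>2 \<le> v\<^sup>2" using that by (rule power_mono[rotated])
    then show ?thesis unfolding q_def by (intro finite_measure_mono) auto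
  qed
  \<comment> \<open>As a function of \<open>u\<close> on the whole line \<open>q\<close> is even, so
    monotonicity is used in the level \<open>a\<close>, with a sign to make it increasing, and then
    composed with squaring.\<close>
  have "mono (\<lambda>a. - prob {y \<in> space M. a \<le> f y})"
    by (intro monoI) (auto intro!: finite_measure_mono)
  then have "(\<lambda>a. - prob {y \<in> space M. a \<le> f y}) \<in> borel_measurable borel"
    by (rule borel_measurable_mono)
  then have "(\<lambda>u. - (- prob {y \<in> space M. u\<^sup>2 \<le> f y})) \<in> borel_measurable borel"
    by measurable
  then have q_meas [measurable]: "q \<in> borel_measurable borel"
    by (simp add: q_def[abs_def])
  have "prob {y \<in> space M. f y < u\<^sup>2} = 1 - q u" for u
  proof -
    have "space M - {y \<in> space M. u\<^sup>2 \<le> f y} = {y \<in> space M. f y < u\<^sup>2}" by auto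
    then show ?thesis using prob_compl[of "{y \<in> space M. u\<^sup>2 \<le> f y}"] by (simp add: q_def)
  qed
  then have q_lim: "((\<lambda>u. (1 - q u) / u) \<longlongrightarrow> c) (at_right 0)"
    using lim by simp
  have q_int: "integrable lborel (\<lambda>u. 2 * max 0 u * q u)"
  proof (rule integrableI_nonneg)
    \<comment> \<open>The layer cake formula for a single sample turns integrability of
      \<open>f\<close> into that of \<open>2 * max 0 u * q u\<close>.\<close>
    have "(\<integral>\<^sup>+u. ennreal (2 * max 0 u * q u) \<partial>lborel) = (\<integral>\<^sup>+y. ennreal (f y) \<partial>M)"
      using nonneg
      by (subst nn_integral_square_layer_cake) (auto simp: q_def emeasure_eq_measure ennreal_mult'[symmetric])
    also have "\<dots> < \<infinity>"
      using int nonneg by (simp add: nn_integral_eq_integral)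
    finally show "(\<integral>\<^sup>+u. ennreal (2 * max 0 u * q u) \<partial>lborel) < \<infinity>" .
  qed (auto simp: q_def)
  have "(\<lambda>k. (real k)\<^sup>2 * (LBINT u. 2 * max 0 u * q u ^ k)) \<longlonglongrightarrow> 2 / c\<^sup>2"
    by (rule survival_power_integral_asymptotics[OF q_meas _ _ q_mono q_lim \<open>0 < c\<close> q_int])
       (auto simp: q_def)
  moreover have "\<forall>\<^sub>F k in sequentially. (real k)\<^sup>2 * (LBINT u. 2 * max 0 u * q u ^ k)
      = (real k)\<^sup>2 * (\<integral>\<omega>. Min ((\<lambda>i. f (\<omega> i)) ` {1..k}) \<partial>(\<Pi>\<^sub>M i\<in>{1..k}. M))"
    using eventually_ge_at_top[of 1]
  proof eventually_elim
    case (elim k)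
    let ?P = "\<Pi>\<^sub>M i\<in>{1..k}. M"
    \<comment> \<open>Without samples \<open>Min\<close> would be taken over the empty set.\<close>
    have ne: "{1..k} \<noteq> {}" using elim by simp
    have "(\<integral>\<omega>. Min ((\<lambda>i. f (\<omega> i)) ` {1..k}) \<partial>?P) = enn2real (\<integral>\<^sup>+\<omega>. ennreal (Min ((\<lambda>i. f (\<omega> i)) ` {1..k})) \<partial>?P)"
    proof (rule integral_eq_nn_integral)
      show "(\<lambda>\<omega>. Min ((\<lambda>i. f (\<omega> i)) ` {1..k})) \<in> borel_measurable ?P" by measurable
      show "AE \<omega> in ?P. 0 \<le> Min ((\<lambda>i. f (\<omega> i)) ` {1..k})" using ne nonneg by simp
    qed
    also have "\<dots> = enn2real (\<integral>\<^sup>+u. ennreal (2 * max 0 u * q u ^ k) \<partial>lborel)"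
      using expectation_iid_Min[of f "{1..k}"] ne nonneg by (simp add: q_def)
    also have "\<dots> = (LBINT u. 2 * max 0 u * q u ^ k)"
      by (rule integral_eq_nn_integral[symmetric]) (auto simp: q_def)
    finally show ?case by simp
  qed
  ultimately show ?thesis by (rule Lim_transform_eventually)
qed

section \<open>Mass of small intervals and the Gaussian case\<close>

text \<open>By continuity the density stays within \<epsilon> of \<open>f t\<close> on a window of
  length \<open>2 * u\<close>, so the mass over \<open>u\<close> lies within
  \<open>2 * \<epsilon>\<close> of \<open>2 * f t\<close>.\<close>

lemma measure_density_small_interval:
  fixes f :: "real \<Rightarrow> real"
  assumes int: "integrable lborel f" and nonneg: "\<And>y. 0 \<le> f y" and cont: "isCont f t"
  shows "((\<lambda>u. measure (density lborel (\<lambda>y. ennreal (f y))) {t - u<..<t + u} / u) \<longlongrightarrow> 2 * f t) (at_right 0)"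
proof (rule tendstoI)
  fix e :: real assume "0 < e"
  \<comment> \<open>The resulting error \<open>2 * \<epsilon>\<close> is \<open>e / 2\<close>,
    strictly below \<open>e\<close>.\<close>
  define \<epsilon> where "\<epsilon> = e / 4"
  have "0 < \<epsilon>" using \<open>0 < e\<close> by (simp add: \<epsilon>_def)
  then obtain d where d: "0 < d" "\<And>y. \<bar>y - t\<bar> < d \<Longrightarrow> \<bar>f y - f t\<bar> < \<epsilon>"
    using cont unfolding continuous_at_eps_delta dist_real_def by blast
  have "dist (measure (density lborel (\<lambda>y. ennreal (f y))) {t - u<..<t + u} / u) (2 * f t) < e"
    if u: "0 < u" "u < d" for u
  proof -
    let ?A = "{t - u<..<t + u}"
    have [measurable]: "f \<in> borel_measurable borel" using int by simp
    have meas: "measure (density lborel (\<lambda>y. ennreal (f y))) ?A = (LBINT y. f y * indicator ?A y)"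
      using nonneg integral_density[of "indicator ?A :: real \<Rightarrow> real" lborel f] by simp
    have f_int: "integrable lborel (\<lambda>y. f y * indicator ?A y)"
      by (rule integrable_real_mult_indicator[OF _ int]) simp
    have const_int: "integrable lborel (\<lambda>y. a * indicator ?A y)"
      and const: "(LBINT y. a * indicator ?A y) = 2 * u * a" for a :: real
      using u by (auto simp: integrable_real_indicator)
    have near: "\<bar>f y - f t\<bar> < \<epsilon>" if "y \<in> ?A" for y
      using that u by (intro d) auto
    have "(LBINT y. (f t - \<epsilon>) * indicator ?A y) \<le> (LBINT y. f y * indicator ?A y)"
      using near by (intro integral_mono const_int f_int) (force split: split_indicator)
    moreover have "(LBINT y. f y * indicator ?A y) \<le> (LBINT y. (f t + \<epsilon>) * indicator ?A y)"
      using near by (intro integral_mono const_int f_int) (force split: split_indicator)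
    ultimately have "2 * (f t - \<epsilon>) \<le> (LBINT y. f y * indicator ?A y) / u"
      and "(LBINT y. f y * indicator ?A y) / u \<le> 2 * (f t + \<epsilon>)"
      using u by (auto simp: const field_simps)
    then show ?thesis
      using \<open>0 < e\<close> unfolding meas dist_real_def \<epsilon>_def by (auto simp: abs_if)
  qed
  then show "\<forall>\<^sub>F u in at_right 0. dist (measure (density lborel (\<lambda>y. ennreal (f y))) {t - u<..<t + u} / u) (2 * f t) < e"
    unfolding eventually_at_right_field using d(1) by blast
qed

lemma prob_space_normal_measure:
  "0 < v \<Longrightarrow> prob_space (normal_measure m v)"
  unfolding normal_measure_def by (intro prob_space_normal_density) simp

lemma integrable_normal_measure_square:
  assumes "0 < v"
  shows "integrable (normal_measure m v) (\<lambda>y. (y - t)\<^sup>2)"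
proof -
  have pos: "0 < sqrt v" using assms by simp
  let ?\<phi> = "normal_density m (sqrt v)"
  \<comment> \<open>This expands \<open>(y - t)\<^sup>2\<close> with
    \<open>y - t = (y - m) + (m - t)\<close>, reducing it to central moments.\<close>
  have "integrable lborel (\<lambda>y. ?\<phi> y * (y - m) ^ 2 + 2 * (m - t) * (?\<phi> y * (y - m) ^ 1) + (m - t)\<^sup>2 * ?\<phi> y)"
    using integrable_normal_moment[OF pos, of m 2] integrable_normal_moment[OF pos, of m 1] integrable_normal_density[OF pos]
    by (intro Bochner_Integration.integrable_add integrable_mult_right) auto
  moreover have "?\<phi> y * (y - m) ^ 2 + 2 * (m - t) * (?\<phi> y * (y - m) ^ 1) + (m - t)\<^sup>2 * ?\<phi> y = ?\<phi> y * (y - t)\<^sup>2" for y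
    by (simp add: power2_eq_square algebra_simps)
  ultimately show ?thesis
    unfolding normal_measure_def by (subst integrable_density) auto
qed

text \<open>The event \<open>(y - t)\<^sup>2 < u\<^sup>2\<close> is the interval of radius
  \<open>u\<close> around \<open>t\<close>, so the slope is
  \<open>c = 2 * ?\<phi> t\<close>.\<close>

lemma normal_measure_Min_square_asymptotics:
  assumes "0 < v"
  shows "(\<lambda>k. (real k)\<^sup>2 * (\<integral>y. Min ((\<lambda>i. (y i - t)\<^sup>2) ` {1..k}) \<partial>(\<Pi>\<^sub>M i\<in>{1..k}. normal_measure m v)))
    \<longlonglongrightarrow> pi * v * exp ((m - t)\<^sup>2 / v)"
proof -
  interpret prob_space "normal_measure m v" by (rule prob_space_normal_measure[OF assms])
  let ?\<phi> = "normal_density m (sqrt v)"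
  have "((\<lambda>u. measure (normal_measure m v) {t - u<..<t + u} / u) \<longlongrightarrow> 2 * ?\<phi> t) (at_right 0)"
    unfolding normal_measure_def
  proof (rule measure_density_small_interval)
    show "isCont ?\<phi> t" unfolding normal_density_def using assms by (intro continuous_intros) auto
  qed (use assms in auto)
  moreover have "\<forall>\<^sub>F u in at_right 0. measure (normal_measure m v) {t - u<..<t + u} / u
      = measure (normal_measure m v) {y \<in> space (normal_measure m v). (y - t)\<^sup>2 < u\<^sup>2} / u"
    using eventually_at_right_less[of "0::real"]
  proof eventually_elim
    case (elim u)
    then have iff: "(y - t)\<^sup>2 < u\<^sup>2 \<longleftrightarrow> y \<in> {t - u<..<t + u}" for y
      using abs_less_iff[of "y - t" u] abs_le_square_iff[of u "y - t"] by auto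
    have "space (normal_measure m v) = UNIV" by (simp add: normal_measure_def)
    then show ?case by (simp only: iff UNIV_I simp_thms Collect_mem_eq)
  qed
  ultimately have "((\<lambda>u. measure (normal_measure m v) {y \<in> space (normal_measure m v). (y - t)\<^sup>2 < u\<^sup>2} / u)
      \<longlongrightarrow> 2 * ?\<phi> t) (at_right 0)"
    by (rule Lim_transform_eventually)
  then have "(\<lambda>k. (real k)\<^sup>2 * (\<integral>y. Min ((\<lambda>i. (y i - t)\<^sup>2) ` {1..k}) \<partial>(\<Pi>\<^sub>M i\<in>{1..k}. normal_measure m v)))
    \<longlonglongrightarrow> 2 / (2 * ?\<phi> t)\<^sup>2"
    using assms by (intro expectation_iid_Min_asymptotics integrable_normal_measure_square)
      (auto intro!: normal_density_pos)
  also have "2 / (2 * ?\<phi> t)\<^sup>2 = pi * v * exp ((m - t)\<^sup>2 / v)"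
  proof -
    \<comment> \<open>Squaring the density removes the 2 from the exponent's denominator; its
      reciprocal then gives the positive exponent of the limit.\<close>
    have "(?\<phi> t)\<^sup>2 = exp (- ((t - m)\<^sup>2 / (2 * v))) ^ 2 / (2 * pi * v)"
      using assms by (simp add: normal_density_def power_divide)
    also have "exp (- ((t - m)\<^sup>2 / (2 * v))) ^ 2 = exp (- ((m - t)\<^sup>2 / v))"
      by (simp add: exp_double[symmetric] power2_commute)
    finally have \<phi>: "(?\<phi> t)\<^sup>2 = exp (- ((m - t)\<^sup>2 / v)) / (2 * pi * v)" .
    show ?thesis
      unfolding power_mult_distrib \<phi> exp_minus using assms by (simp add: field_simps)
  qed
  finally show ?thesis .
qed

section \<open>Positivity of the predictive variance\<close>

lemma matrix_inv_right_of_invertible: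
  "invertible A \<Longrightarrow> A ** matrix_inv A = mat 1"
  unfolding invertible_def matrix_inv_def by (rule someI2_ex) auto

text \<open>With \<open>z = matrix_inv ?M *v x\<close>, the form \<open>x \<bullet> z\<close> equals
  \<open>z \<bullet> (?M *v z)\<close>, which is nonnegative; the noise term
  \<open>\<sigma>\<^sup>2\<close> makes the sum strictly positive. Positivity makes the sample law a
  nondegenerate Gaussian.\<close>

lemma pred_var_pos:
  fixes S :: "real^'d^'d"
  assumes S: "covariance_matrix S" and "0 < R" "0 < \<sigma>"
  shows "0 < pred_var S R \<sigma> \<gamma> x"
proof -
  let ?M = "S + mat R"
  have "mat R *v v = R *\<^sub>R v" for v :: "real^'d"
    by (simp add: mat_def matrix_vector_mult_def vec_eq_iff if_distrib[of "\<lambda>a. a * _"] cong: if_cong)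
  then have quad: "v \<bullet> (?M *v v) = v \<bullet> (S *v v) + R * (v \<bullet> v)" for v
    by (simp add: matrix_vector_mult_add_rdistrib inner_add_right)
  have S_nonneg: "0 \<le> v \<bullet> (S *v v)" for v using S by (simp add: covariance_matrix_def)
  have "v = 0" if "?M *v v = 0" for v
  proof -
    have "R * (v \<bullet> v) \<le> 0" using quad[of v] S_nonneg[of v] that by simp
    then have "v \<bullet> v \<le> 0" using \<open>0 < R\<close> by (simp add: mult_le_0_iff)
    then show ?thesis by (metis inner_gt_zero_iff not_less)
  qed
  then have "invertible ?M"
    by (simp add: invertible_left_inverse matrix_left_invertible_ker)
  then have "?M ** matrix_inv ?M = mat 1" by (rule matrix_inv_right_of_invertible)
  then have x: "x = ?M *v (matrix_inv ?M *v x)"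
    by (simp add: matrix_vector_mul_assoc)
  have "0 \<le> x \<bullet> (matrix_inv ?M *v x)"
    using quad[of "matrix_inv ?M *v x"] S_nonneg \<open>0 < R\<close> x
    by (metis add_nonneg_nonneg inner_commute inner_ge_zero less_imp_le mult_nonneg_nonneg)
  then have "0 \<le> x \<bullet> (B_mat S R *v x)"
    using \<open>0 < R\<close> by (simp add: B_mat_def scaleR_matrix_vector_assoc[symmetric])
  then show ?thesis
    using \<open>0 < \<sigma>\<close> unfolding pred_var_def by (intro add_pos_nonneg) auto
qed

section \<open>The iterated limit for the error\<close>

text \<open>The witness \<open>L\<close> carries the inner limits, so their existence is part of the
  claim.\<close>

theorem mainTheorem2:
  fixes n :: nat and \<alpha> \<sigma> \<gamma> R :: real
    and S :: "real^'d^'d" and w w\<^sub>T w\<^sub>R x :: "real^'d"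
  assumes "n \<ge> 1"
    and "\<alpha> = real CARD('d) / real n" and "\<alpha> < 1"
    and "\<sigma> > 0" and "\<gamma> > 0"
    and "covariance_matrix S"
    and "renormalized_ridge S \<alpha> \<sigma> \<gamma> R"
    and "(norm w)\<^sup>2 = real CARD('d)"
    and "w\<^sub>R = w" and "w\<^sub>T = w"
  shows "\<exists>L :: nat \<Rightarrow> real.
      (\<forall>k\<ge>1. ((\<lambda>T. delta_err S R \<sigma> \<gamma> w\<^sub>T w\<^sub>R x T k) \<longlongrightarrow> L k) (at_right 0)) \<and>
      (\<lambda>k. (real k)\<^sup>2 * L k) \<longlonglongrightarrow>
        pi * pred_var S R \<sigma> \<gamma> x * exp ((Delta_T S R w\<^sub>T x)\<^sup>2 / pred_var S R \<sigma> \<gamma> x)"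
proof -
  define v where "v = pred_var S R \<sigma> \<gamma> x"
  define m where "m = pred_mean S R w x"
  define t where "t = lin_mean w x"
  let ?N = "normal_measure m v"
  let ?L = "\<lambda>k. \<integral>y. Min ((\<lambda>i. (y i - t)\<^sup>2) ` {1..k}) \<partial>(\<Pi>\<^sub>M i\<in>{1..k}. ?N)"
  have "0 < v"
    using assms by (auto simp: v_def renormalized_ridge_def intro: pred_var_pos)
  have "((\<lambda>T. delta_err S R \<sigma> \<gamma> w\<^sub>T w\<^sub>R x T k) \<longlongrightarrow> ?L k) (at_right 0)" if "1 \<le> k" for k
  proof -
    have N: "prob_space ?N" using \<open>0 < v\<close> by (rule prob_space_normal_measure)
    interpret P: prob_space "\<Pi>\<^sub>M i\<in>{1..k}. ?N" by (rule prob_space_PiM) (rule N)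
    have "integrable (\<Pi>\<^sub>M i\<in>{1..k}. ?N) (\<lambda>y. (y i - t)\<^sup>2)" if "i \<in> {1..k}" for i
    proof -
      \<comment> \<open>Each coordinate of the product has law \<open>?N\<close>, which transfers
        the finite second moment.\<close>
      have "distr (\<Pi>\<^sub>M i\<in>{1..k}. ?N) ?N (\<lambda>y. y i) = ?N"
        using N that by (intro distr_PiM_component)
      then have "integrable (distr (\<Pi>\<^sub>M i\<in>{1..k}. ?N) ?N (\<lambda>y. y i)) (\<lambda>y. (y - t)\<^sup>2)"
        using integrable_normal_measure_square[OF \<open>0 < v\<close>] by simp
      then show ?thesis
        using that by (subst (asm) integrable_distr_eq) (auto simp: normal_measure_def)
    qed
    \<comment> \<open>Since reward and teacher weights agree, the energy in the Boltzmann weight is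
      the squared error itself, so the average is a softmin.\<close>
    then have "((\<lambda>T. P.expectation (\<lambda>y. (\<Sum>i\<in>{1..k}. (y i - t)\<^sup>2 * exp (- (y i - t)\<^sup>2 / T))
        / (\<Sum>j\<in>{1..k}. exp (- (y j - t)\<^sup>2 / T)))) \<longlongrightarrow> ?L k) (at_right 0)"
      using that by (intro P.expectation_softmin_tendsto) auto
    then show ?thesis
      using assms by (simp add: delta_err_def m_def v_def t_def)
  qed
  moreover have "(\<lambda>k. (real k)\<^sup>2 * ?L k) \<longlonglongrightarrow>
      pi * pred_var S R \<sigma> \<gamma> x * exp ((Delta_T S R w\<^sub>T x)\<^sup>2 / pred_var S R \<sigma> \<gamma> x)"
    unfolding Delta_T_def \<open>w\<^sub>T = w\<close> v_def[symmetric] m_def[symmetric] t_def[symmetric]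
    by (rule normal_measure_Min_square_asymptotics[OF \<open>0 < v\<close>])
  ultimately show ?thesis by (intro exI[of _ ?L]) auto
qed

end
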